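(* Let $\mathbb{K}$ be an algebraically closed field and let $T\in\mathbb{K}^{n_1}\otimes\mathbb{K}^{n_2}\otimes\mathbb{K}^{n_3}$. For any positive integers $m_1,m_2,m_3$ there is a tensor $S\in\mathbb{K}^{m_1}\otimes\mathbb{K}^{m_2}\otimes\mathbb{K}^{m_3}$ such that $T\geq S$ and for every distinct $i,j,k\in\{1,2,3\}$ we have $$Q_i(S)=\min\{Q_i(T),m_j,m_k\}.$$
   Context: Restriction: for $T\in\mathbb{K}^{n_1}\otimes\mathbb{K}^{n_2}\otimes\mathbb{K}^{n_3}$ and $S\in\mathbb{K}^{m_1}\otimes\mathbb{K}^{m_2}\otimes\mathbb{K}^{m_3}$, write $T\geq S$ if there are linear maps $A_i:\mathbb{K}^{n_i}\to\mathbb{K}^{m_i}$ with $(A_1\otimes A_2\otimes A_3)T=S$. For $\{i,j,k\}=\{1,2,3\}$, let $T^{(i)}:(\mathbb{K}^{n_i})^*\to\mathbb{K}^{n_j}\otimes\mathbb{K}^{n_k}$ be the $i$-th flattening of $T$, i.e. the linear map contracting the $i$-th tensor factor of $T$ with a given functional. Its image is regarded as a linear space of $n_j\times n_k$ matrices (the span of the $i$-slices of $T$). Define $Q_i(T)$ to be the largest matrix rank of any element of $T^{(i)}((\mathbb{K}^{n_i})^* )$. *)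

theory Defs
  imports "Jordan_Normal_Form.DL_Rank"
begin

text \<open>
  A tensor in \<open>K^(n 1) \<otimes> K^(n 2) \<otimes> K^(n 3)\<close> is its coordinate array in the standard basis, with
  indices starting at 0. The dimensions form a function \<open>n\<close> on the factor numbers 1, 2, 3. Entries
  outside the box are 0, so each tensor has exactly one representative.
\<close>

type_synonym 'a tensor3 = "nat \<Rightarrow> nat \<Rightarrow> nat \<Rightarrow> 'a"

definition tensor_space :: "(nat \<Rightarrow> nat) \<Rightarrow> ('a :: zero) tensor3 set" where
  "tensor_space n = {T. \<forall>a b c. \<not> (a < n 1 \<and> b < n 2 \<and> c < n 3) \<longrightarrow> T a b c = 0}"

text \<open>The image \<open>(A\<^sub>1 \<otimes> A\<^sub>2 \<otimes> A\<^sub>3) T\<close>; linear maps \<open>K^n \<rightarrow> K^m\<close> are given by \<open>m \<times> n\<close> matrices.\<close>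

definition tensor_map ::
  "'a mat \<Rightarrow> 'a mat \<Rightarrow> 'a mat \<Rightarrow> ('a :: comm_semiring_0) tensor3 \<Rightarrow> 'a tensor3" where
  "tensor_map A\<^sub>1 A\<^sub>2 A\<^sub>3 T = (\<lambda>a b c.
     if a < dim_row A\<^sub>1 \<and> b < dim_row A\<^sub>2 \<and> c < dim_row A\<^sub>3
     then \<Sum>a'<dim_col A\<^sub>1. \<Sum>b'<dim_col A\<^sub>2. \<Sum>c'<dim_col A\<^sub>3.
            A\<^sub>1 $$ (a, a') * A\<^sub>2 $$ (b, b') * A\<^sub>3 $$ (c, c') * T a' b' c'
     else 0)"

text \<open>\<open>T \<ge> S\<close>, for \<open>T\<close> of format \<open>n\<close> and \<open>S\<close> of format \<open>m\<close>.\<close>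

definition restricts_to ::
  "(nat \<Rightarrow> nat) \<Rightarrow> (nat \<Rightarrow> nat) \<Rightarrow> ('a :: comm_semiring_0) tensor3 \<Rightarrow> 'a tensor3 \<Rightarrow> bool" where
  "restricts_to n m T S \<longleftrightarrow>
     (\<exists>A\<^sub>1 \<in> carrier_mat (m 1) (n 1). \<exists>A\<^sub>2 \<in> carrier_mat (m 2) (n 2). \<exists>A\<^sub>3 \<in> carrier_mat (m 3) (n 3).
        tensor_map A\<^sub>1 A\<^sub>2 A\<^sub>3 T = S)"

text \<open>
  The flattening \<open>T\<^sup>(\<^sup>i\<^sup>)\<close>, for \<open>i = 1, 2, 3\<close>. The vector \<open>\<phi>\<close> holds the coordinates of a functional in
  the dual basis. The other two factors are kept in increasing order, so for \<open>i = 2\<close> the result is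
  an \<open>n 1 \<times> n 3\<close> matrix; the opposite order transposes it and does not change its rank.
\<close>

definition flattening ::
  "(nat \<Rightarrow> nat) \<Rightarrow> ('a :: comm_semiring_0) tensor3 \<Rightarrow> nat \<Rightarrow> 'a vec \<Rightarrow> 'a mat" where
  "flattening n T i \<phi> =
     (if i = 1 then mat (n 2) (n 3) (\<lambda>(b, c). \<Sum>a<n 1. \<phi> $ a * T a b c)
      else if i = 2 then mat (n 1) (n 3) (\<lambda>(a, c). \<Sum>b<n 2. \<phi> $ b * T a b c)
      else mat (n 1) (n 2) (\<lambda>(a, b). \<Sum>c<n 3. \<phi> $ c * T a b c))"

abbreviation mat_rank :: "('a :: field) mat \<Rightarrow> nat" where
  "mat_rank M \<equiv> vec_space.rank (dim_row M) M"

definition max_rank :: "(nat \<Rightarrow> nat) \<Rightarrow> ('a :: field) tensor3 \<Rightarrow> nat \<Rightarrow> nat" where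
  "max_rank n T i = Max ((\<lambda>\<phi>. mat_rank (flattening n T i \<phi>)) ` carrier_vec (n i))"

text \<open>The maximum is taken over a finite nonempty set, hence is attained.\<close>

lemma finite_flattening_ranks:
  fixes T :: "('a :: field) tensor3"
  shows "finite ((\<lambda>\<phi>. mat_rank (flattening n T i \<phi>)) ` carrier_vec (n i))"
proof (rule finite_subset)
  let ?N = "n 2 + n 3"
  show "(\<lambda>\<phi>. mat_rank (flattening n T i \<phi>)) ` carrier_vec (n i) \<subseteq> {..?N}"
  proof clarify
    fix \<phi> :: "'a vec"
    have "mat_rank (flattening n T i \<phi>) \<le> dim_col (flattening n T i \<phi>)"
      by (rule vec_space.rank_le_nc[OF carrier_matI]) (rule refl)+
    also have "dim_col (flattening n T i \<phi>) \<le> ?N"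
      by (simp add: flattening_def)
    finally show "mat_rank (flattening n T i \<phi>) \<le> ?N" .
  qed
qed simp

lemma max_rank_attained:
  "\<exists>\<phi> \<in> carrier_vec (n i). max_rank n T i = mat_rank (flattening n T i \<phi>)"
proof -
  let ?R = "(\<lambda>\<phi>. mat_rank (flattening n T i \<phi>)) ` carrier_vec (n i)"
  have "0\<^sub>v (n i) \<in> carrier_vec (n i)" by (rule zero_carrier_vec)
  then have "?R \<noteq> {}" by blast
  then have "max_rank n T i \<in> ?R"
    unfolding max_rank_def by (rule Max_in[OF finite_flattening_ranks])
  then show ?thesis by (rule imageE) (rule bexI)
qed

end

theory Submission
  imports Defs "Jordan_Normal_Form.DL_Rank_Submatrix"
begin

text \<open>
  Restriction never increases \<open>Q\<^sub>i\<close>, so the right-hand side \<open>r\<^sub>i\<close> always bounds \<open>Q\<^sub>i(S)\<close>. For the other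
  direction \<open>S\<close> is the image of \<open>T\<close> under generic maps: \<open>Q\<^sub>i(S) \<ge> r\<^sub>i\<close> holds as soon as the leading
  \<open>r\<^sub>i\<close>-minor of the first \<open>i\<close>-slice of \<open>S\<close> is nonzero, which is a polynomial condition on the maps. Each
  of the three conditions can be met separately, and over an infinite field they can be met together:
  on the line joining a nonzero of one polynomial to a nonzero of another, both are nonzero outside
  finitely many points.
\<close>

section \<open>Rank expressed by factoring the identity\<close>

text \<open>Extend \<open>us\<close> to a basis by unit vectors. The matrix with these columns is
  invertible, and the first \<open>length us\<close> rows of its inverse serve as
  \<open>P\<close>.\<close>

lemma (in vec_space) lin_indpt_left_inverse:
  assumes "distinct us" "set us \<subseteq> carrier_vec n" "lin_indpt (set us)"
  shows "\<exists>P \<in> carrier_mat (length us) n. P * mat_of_cols n us = 1\<^sub>m (length us)"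
proof -
  let ?S = "set us \<union> set (unit_vecs n)" and ?r = "length us"
  have S: "?S \<subseteq> carrier_vec n" using assms(2) unit_vecs_carrier by auto
  obtain B where B: "finite B" "maximal B (\<lambda>T. T \<subseteq> ?S \<and> lin_indpt T)" "set us \<subseteq> B"
    using maximal_exists_superset[of ?S "\<lambda>T. T \<subseteq> ?S \<and> lin_indpt T" "set us"] assms(3) by auto
  have BS: "B \<subseteq> ?S" "lin_indpt B" using B(2) by (auto simp: maximal_def)
  \<comment> \<open>The unit vectors make \<open>?S\<close> spanning, so the maximal independent
    subset \<open>B\<close> is a basis and has \<open>n\<close> elements.\<close>
  have "carrier_vec n \<subseteq> span ?S"
    using span_is_monotone[of "set (unit_vecs n)" ?S] by (simp add: span_unit_vecs_is_carrier)
  then have "span ?S = carrier_vec n" using span_is_subset2[OF S] S by (intro equalityI) auto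
  then have "span_vs ?S = V" by (simp add: module_vec_def)
  then have cardB: "card B = n" using dim_span[OF _ _ B(2)] S by (simp add: dim_is_n)
  obtain ws where ws: "set ws = B - set us" "distinct ws"
    using finite_distinct_list[of "B - set us"] B(1) by auto
  define bs where "bs = us @ ws"
  have bs: "set bs = B" "distinct bs" using ws B(3) assms(1) by (auto simp: bs_def)
  then have len: "length bs = n" using cardB distinct_card by metis
  define A where "A = mat_of_cols n bs"
  have A: "A \<in> carrier_mat n n" using len by (auto simp: A_def)
  have cols: "cols A = bs" unfolding A_def using BS S bs by (intro cols_mat_of_cols) auto
  have "det A \<noteq> 0"
    using det_rank_iff[OF A] lin_indpt_full_rank[OF A] BS bs by (simp add: cols)
  then obtain A' where A': "A' \<in> carrier_mat n n" "A' * A = 1\<^sub>m n"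
    using det_non_zero_imp_unit[OF A] by (auto simp: Units_def ring_mat_def)
  \<comment> \<open>Since \<open>bs\<close> starts with \<open>us\<close>, the columns of
    \<open>mat_of_cols n us\<close> are the first columns of \<open>A\<close>; truncating
    \<open>A'\<close> to its first rows leaves the top left block of the identity.\<close>
  have rn: "?r \<le> n" using len by (simp add: bs_def)
  define P where "P = mat ?r n (\<lambda>(i, j). A' $$ (i, j))"
  have "P * mat_of_cols n us = 1\<^sub>m ?r"
  proof (rule eq_matI)
    fix i j assume ij: "i < dim_row (1\<^sub>m ?r :: 'a mat)" "j < dim_col (1\<^sub>m ?r :: 'a mat)"
    have "row P i = row A' i" using ij rn A' by (intro eq_vecI) (auto simp: P_def)
    moreover have "col (mat_of_cols n us) j = col A j"
      using ij rn A len by (intro eq_vecI) (auto simp: A_def mat_of_cols_index bs_def nth_append)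
    ultimately have "(P * mat_of_cols n us) $$ (i, j) = (A' * A) $$ (i, j)"
      using ij rn A A'(1) by (auto simp: P_def)
    then show "(P * mat_of_cols n us) $$ (i, j) = 1\<^sub>m ?r $$ (i, j)"
      using ij rn by (simp add: A'(2))
  qed (auto simp: P_def)
  then show ?thesis by (intro bexI[of _ P]) (auto simp: P_def)
qed

lemma (in vec_space) rank_le_nr:
  assumes "A \<in> carrier_mat n nc"
  shows "rank A \<le> n"
  using subspace_dim[OF span_is_subspace fin_dim fin_dim_span_cols[OF assms]]
    cols_dim[of A] assms by (simp add: rank_def dim_is_n)

text \<open>\<open>Q\<close> selects \<open>r\<close> independent columns of \<open>A\<close>, and
  \<open>P\<close> is a left inverse of the selected columns. With its converse below, this turns
  rank bounds into matrix equations, which suit products better than spans do.\<close>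

lemma (in vec_space) identity_factor_of_rank:
  assumes A: "A \<in> carrier_mat n nc" and r: "r \<le> rank A"
  shows "\<exists>P \<in> carrier_mat r n. \<exists>Q \<in> carrier_mat nc r. P * A * Q = 1\<^sub>m r"
proof -
  obtain S where S: "maximal S (\<lambda>T. T \<subseteq> set (cols A) \<and> lin_indpt T)"
    using maximal_exists_superset[of "set (cols A)" "\<lambda>T. T \<subseteq> set (cols A) \<and> lin_indpt T" "{}"]
    by (auto simp: lin_dep_def)
  then have S': "S \<subseteq> set (cols A)" "lin_indpt S" by (auto simp: maximal_def)
  have "r \<le> card S" using r rank_card_indpt[OF A S] by simp
  then obtain U where U: "U \<subseteq> S" "card U = r" "finite U"
    using obtain_subset_with_card_n by metis
  obtain us where us: "set us = U" "distinct us" using finite_distinct_list U by auto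
  have len: "length us = r" using us U distinct_card by force
  have sub: "set us \<subseteq> set (cols A)" using us U S' by auto
  have car: "set us \<subseteq> carrier_vec n" using sub cols_dim[of A] A by auto
  have "lin_indpt (set us)" using S' us U subset_li_is_li by metis
  then obtain P where P: "P \<in> carrier_mat r n" "P * mat_of_cols n us = 1\<^sub>m r"
    using lin_indpt_left_inverse[OF us(2) car] len by auto
  have "\<forall>i<r. \<exists>j<nc. us ! i = col A j"
  proof (intro allI impI)
    fix i assume "i < r"
    then have "us ! i \<in> set (cols A)" using sub len by (meson nth_mem subsetD)
    then show "\<exists>j<nc. us ! i = col A j" using A by (auto simp: in_set_conv_nth)
  qed
  then obtain f where f: "\<And>i. i < r \<Longrightarrow> f i < nc \<and> us ! i = col A (f i)" by metis
  \<comment> \<open>Multiplying by a unit vector on the right extracts a column, so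
    \<open>A * Q\<close> consists of the chosen columns.\<close>
  define Q :: "'a mat" where "Q = mat_of_cols nc (map (\<lambda>i. unit_vec nc (f i)) [0..<r])"
  have Q: "Q \<in> carrier_mat nc r" by (auto simp: Q_def)
  have "A * Q = mat_of_cols n us"
  proof (rule eq_matI)
    fix i j assume ij: "i < dim_row (mat_of_cols n us)" "j < dim_col (mat_of_cols n us)"
    have "col Q j = unit_vec nc (f j)" using ij len by (simp add: Q_def col_mat_of_cols)
    then show "(A * Q) $$ (i, j) = mat_of_cols n us $$ (i, j)"
      using ij len f[of j] A Q by (simp add: mat_of_cols_index)
  qed (use A Q len in auto)
  then have "P * A * Q = 1\<^sub>m r" using P A Q by (simp add: assoc_mult_mat[of P r n A nc Q r])
  then show ?thesis using P Q by blast
qed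

text \<open>The left inverse \<open>P\<close> makes the \<open>r\<close> columns of
  \<open>A * Q\<close> independent, and they all lie in the column space of
  \<open>A\<close>.\<close>

lemma (in vec_space) rank_of_identity_factor:
  assumes A: "A \<in> carrier_mat n nc" and P: "P \<in> carrier_mat r n" and Q: "Q \<in> carrier_mat nc r"
    and PAQ: "P * A * Q = 1\<^sub>m r"
  shows "r \<le> rank A"
proof -
  let ?W = "span (set (cols A))"
  have cA: "set (cols A) \<subseteq> carrier_vec n" using cols_dim[of A] A by auto
  define B where "B = A * Q"
  have B: "B \<in> carrier_mat n r" using A Q by (simp add: B_def)
  have PB: "P * B = 1\<^sub>m r" using PAQ A P Q by (simp add: B_def assoc_mult_mat[of P r n A nc Q r])
  \<comment> \<open>Independence speaks of the set of columns, so its size is \<open>r\<close> only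
    if no two columns coincide.\<close>
  have dist: "distinct (cols B)"
  proof -
    have "i = j" if "i < r" "j < r" "col B i = col B j" for i j
    proof (rule ccontr)
      assume "i \<noteq> j"
      have "(P * B) $$ (i, i) = (P * B) $$ (i, j)" using that P B by simp
      then show False using that \<open>i \<noteq> j\<close> by (simp add: PB)
    qed
    then show ?thesis using B by (auto simp: distinct_conv_nth)
  qed
  have li: "lin_indpt (set (cols B))"
  proof
    assume "lin_dep (set (cols B))"
    then obtain v where v: "v \<in> carrier_vec r" "v \<noteq> 0\<^sub>v r" "B *\<^sub>v v = 0\<^sub>v n"
      using lin_depE[OF B _ dist] by blast
    have "v = (P * B) *\<^sub>v v" using v by (simp add: PB)
    also have "\<dots> = P *\<^sub>v (B *\<^sub>v v)" using P B v by simp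
    also have "\<dots> = 0\<^sub>v r" using P v by auto
    finally show False using v by simp
  qed
  have sub: "set (cols B) \<subseteq> ?W"
  proof
    fix x assume "x \<in> set (cols B)"
    then obtain j where j: "j < r" "x = col B j" using B by (auto simp: in_set_conv_nth)
    have "x = A *\<^sub>v col Q j" unfolding j(2) B_def by (rule col_mult2[OF A Q j(1)])
    then show "x \<in> ?W"
      using A Q j col_space_eq[OF A] by (auto simp: col_space_def intro!: mult_mat_vec_carrier)
  qed
  \<comment> \<open>The rank is the dimension of the column space as a space of its own, so
    independence must be carried over from the ambient space.\<close>
  have sm: "submodule class_ring ?W V" using span_is_submodule cA by simp
  interpret W: vectorspace class_ring "span_vs (set (cols A))"
    using span_is_subspace[THEN subspace_is_vs] cA by simp
  have "W.lin_indpt (set (cols B))"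
    using span_li_not_depend(2)[OF sub sm] li by simp
  then have "card (set (cols B)) \<le> W.dim"
    using W.li_le_dim(2)[OF fin_dim_span_cols[OF A]] sub by simp
  then show ?thesis using distinct_card[OF dist] B by (simp add: rank_def)
qed

lemma mat_rank_ge_top_left_minor:
  fixes A :: "'a :: field mat"
  assumes "r \<le> dim_row A" "r \<le> dim_col A"
    and "det (mat r r (\<lambda>(i, j). A $$ (i, j))) \<noteq> 0"
  shows "r \<le> mat_rank A"
proof -
  \<comment> \<open>\<open>submatrix\<close> enumerates the chosen indices in increasing order by
    \<open>pick\<close>; on an initial segment this is the identity.\<close>
  have pick: "pick {..<r} i = i" if "i < r" for i
  proof -
    have "{a \<in> {..<r}. a < i} = {..<i}" using that by auto
    then show ?thesis using pick_card_in_set[of i "{..<r}"] that by simp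
  qed
  have restr: "{i. i < k \<and> i \<in> {..<r}} = {..<r}" if "r \<le> k" for k
    using that by auto
  have "submatrix A {..<r} {..<r} = mat r r (\<lambda>(i, j). A $$ (i, j))"
    unfolding submatrix_def restr[OF assms(1)] restr[OF assms(2)]
    by (rule eq_matI) (simp_all add: pick)
  then have "card {j. j < dim_col A \<and> j \<in> {..<r}} \<le> mat_rank A"
    using assms(3) by (intro vec_space.rank_gt_minor[of _ _ "dim_col A" "{..<r}"]) auto
  then show ?thesis unfolding restr[OF assms(2)] by simp
qed

text \<open>If \<open>P\<close> and \<open>Q\<close> factor the identity through
  \<open>A * M * B\<close>, then \<open>P * A\<close> and \<open>B * Q\<close> factor it through
  \<open>M\<close>.\<close>

lemma mat_rank_mult_le:
  fixes M :: "'a :: field mat"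
  assumes A: "A \<in> carrier_mat k p" and M: "M \<in> carrier_mat p q" and B: "B \<in> carrier_mat q l"
  shows "mat_rank (A * M * B) \<le> mat_rank M"
proof -
  let ?N = "A * M * B" and ?r = "vec_space.rank k (A * M * B)"
  have N: "?N \<in> carrier_mat k l" using A M B by simp
  then obtain P Q where PQ: "P \<in> carrier_mat ?r k" "Q \<in> carrier_mat l ?r" "P * ?N * Q = 1\<^sub>m ?r"
    using vec_space.identity_factor_of_rank[OF _ order_refl] by blast
  have AM: "A * M \<in> carrier_mat k q" and BQ: "B * Q \<in> carrier_mat q ?r" using A M B PQ by auto
  have "P * ?N * Q = (P * A) * M * (B * Q)"
    by (simp only: assoc_mult_mat[OF PQ(1) N PQ(2)] assoc_mult_mat[OF AM B PQ(2)]
        assoc_mult_mat[OF PQ(1) AM BQ, symmetric] assoc_mult_mat[OF PQ(1) A M])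
  then show ?thesis
    using vec_space.rank_of_identity_factor[of M p q "P * A" ?r "B * Q"] A M B PQ by simp
qed

section \<open>Polynomial conditions and generic points\<close>

text \<open>Stands in for polynomials in many variables; restrictions to lines are all the argument uses.\<close>

definition poly_on_lines :: "(('i \<Rightarrow> 'a) \<Rightarrow> 'a :: comm_ring_1) \<Rightarrow> bool" where
  "poly_on_lines f \<longleftrightarrow> (\<forall>x y. \<exists>p. \<forall>t. f (\<lambda>i. (1 - t) * x i + t * y i) = poly p t)"

lemma poly_on_lines_const: "poly_on_lines (\<lambda>x. c)"
  unfolding poly_on_lines_def by (intro allI exI[of _ "[:c:]"]) simp

lemma poly_on_lines_coord: "poly_on_lines (\<lambda>x. x i)"
  unfolding poly_on_lines_def
proof (intro allI)
  fix x y :: "'a \<Rightarrow> 'b"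
  show "\<exists>p. \<forall>t. (1 - t) * x i + t * y i = poly p t"
    by (intro exI[of _ "[:x i, y i - x i:]"]) (simp add: algebra_simps)
qed

lemma poly_on_lines_mult:
  assumes "poly_on_lines f" "poly_on_lines g"
  shows "poly_on_lines (\<lambda>x. f x * g x)"
  using assms unfolding poly_on_lines_def by (metis poly_mult)

lemma poly_on_lines_sum:
  assumes "\<And>j. j \<in> J \<Longrightarrow> poly_on_lines (f j)"
  shows "poly_on_lines (\<lambda>x. \<Sum>j\<in>J. f j x)"
  unfolding poly_on_lines_def
proof (intro allI)
  fix x y
  have "\<forall>j\<in>J. \<exists>p. \<forall>t. f j (\<lambda>i. (1 - t) * x i + t * y i) = poly p t"
    using assms unfolding poly_on_lines_def by blast
  then obtain p where "\<And>j t. j \<in> J \<Longrightarrow> f j (\<lambda>i. (1 - t) * x i + t * y i) = poly (p j) t"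
    by metis
  then show "\<exists>p. \<forall>t. (\<Sum>j\<in>J. f j (\<lambda>i. (1 - t) * x i + t * y i)) = poly p t"
    by (intro exI[of _ "\<Sum>j\<in>J. p j"]) (simp add: poly_sum)
qed

lemma poly_on_lines_prod:
  assumes "\<And>j. j \<in> J \<Longrightarrow> poly_on_lines (f j)"
  shows "poly_on_lines (\<lambda>x. \<Prod>j\<in>J. f j x)"
  unfolding poly_on_lines_def
proof (intro allI)
  fix x y
  have "\<forall>j\<in>J. \<exists>p. \<forall>t. f j (\<lambda>i. (1 - t) * x i + t * y i) = poly p t"
    using assms unfolding poly_on_lines_def by blast
  then obtain p where "\<And>j t. j \<in> J \<Longrightarrow> f j (\<lambda>i. (1 - t) * x i + t * y i) = poly (p j) t"
    by metis
  then show "\<exists>p. \<forall>t. (\<Prod>j\<in>J. f j (\<lambda>i. (1 - t) * x i + t * y i)) = poly p t"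
    by (intro exI[of _ "\<Prod>j\<in>J. p j"]) (simp add: poly_prod)
qed

lemma poly_on_lines_det:
  assumes "\<And>i j. poly_on_lines (\<lambda>x. F x i j)"
  shows "poly_on_lines (\<lambda>x. det (mat r r (\<lambda>(i, j). F x i j)))"
proof -
  \<comment> \<open>Leibniz expansion; a permutation of \<open>{0..<r}\<close> keeps its values
    below \<open>r\<close>, so every index stays inside the matrix.\<close>
  have "det (mat r r (\<lambda>(i, j). F x i j)) =
      (\<Sum>p \<in> {p. p permutes {0..<r}}. signof p * (\<Prod>i = 0..<r. F x i (p i)))" for x
    unfolding det_def'[OF mat_carrier]
    by (intro sum.cong prod.cong arg_cong2[where f = "(*)"] refl)
      (auto simp: permutes_in_image[where S = "{0..<r}", simplified])
  then show ?thesis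
    by (simp only:) (intro poly_on_lines_sum poly_on_lines_mult poly_on_lines_const
      poly_on_lines_prod assms)
qed

lemma poly_on_lines_common_nonzero:
  fixes f g :: "('i \<Rightarrow> 'a :: idom) \<Rightarrow> 'a"
  assumes inf: "infinite (UNIV :: 'a set)"
    and f: "poly_on_lines f" "f x \<noteq> 0" and g: "poly_on_lines g" "g y \<noteq> 0"
  shows "\<exists>z. f z * g z \<noteq> 0"
proof -
  let ?l = "\<lambda>t i. (1 - t) * x i + t * y i"
  obtain p q where p: "\<And>t. f (?l t) = poly p t" and q: "\<And>t. g (?l t) = poly q t"
    using f(1) g(1) unfolding poly_on_lines_def by metis
  \<comment> \<open>The line passes through \<open>x\<close> at parameter 0 and through
    \<open>y\<close> at parameter 1.\<close>
  have "p \<noteq> 0" using p[of 0] f(2) by auto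
  moreover have "q \<noteq> 0" using q[of 1] g(2) by auto
  ultimately have "finite {t. poly (p * q) t = 0}" by (intro poly_roots_finite) simp
  then obtain t where "poly (p * q) t \<noteq> 0" using ex_new_if_finite[OF inf] by blast
  then show ?thesis by (intro exI[of _ "?l t"]) (simp add: p q)
qed

text \<open>Over a finite field the product of all \<open>[:- a, 1:]\<close> vanishes everywhere, so
  adding 1 gives a nonconstant polynomial without a root.\<close>

lemma infinite_UNIV_alg_closed: "infinite (UNIV :: 'a :: alg_closed_field set)"
proof
  assume fin: "finite (UNIV :: 'a set)"
  define p :: "'a poly" where "p = (\<Prod>a\<in>UNIV. [:- a, 1:])"
  have "degree p = card (UNIV :: 'a set)"
    unfolding p_def by (subst degree_prod_sum_eq) simp_all
  then have "degree (p + 1) > 0"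
    using fin by (simp add: degree_add_eq_left card_gt_0_iff)
  then obtain a where "poly (p + 1) a = 0" using alg_closed_imp_poly_has_root by blast
  moreover have "poly p a = 0" unfolding p_def poly_prod using fin by (intro prod_zero) auto
  ultimately show False by simp
qed

section \<open>Flattenings under restriction\<close>

text \<open>Pairing \<phi> with the first factor after \<open>A\<close> is pairing its pullback
  \<open>A\<^sup>T *\<^sub>v \<phi>\<close> before \<open>A\<close>, while \<open>B\<close> and
  \<open>C\<close> act on the rows and columns of the flattening.\<close>

lemma flattening_tensor_map:
  fixes T :: "'a :: field tensor3" and n m :: "nat \<Rightarrow> nat"
  assumes A: "A \<in> carrier_mat (m 1) (n 1)" and B: "B \<in> carrier_mat (m 2) (n 2)"
    and C: "C \<in> carrier_mat (m 3) (n 3)" and \<phi>: "\<phi> \<in> carrier_vec (m 1)"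
  shows "flattening m (tensor_map A B C T) 1 \<phi> = B * flattening n T 1 (A\<^sup>T *\<^sub>v \<phi>) * C\<^sup>T"
proof (rule eq_matI)
  fix b c
  assume "b < dim_row (B * flattening n T 1 (A\<^sup>T *\<^sub>v \<phi>) * C\<^sup>T)"
    and "c < dim_col (B * flattening n T 1 (A\<^sup>T *\<^sub>v \<phi>) * C\<^sup>T)"
  then have bc: "b < m 2" "c < m 3" using B C by auto
  have "flattening m (tensor_map A B C T) 1 \<phi> $$ (b, c) =
      (\<Sum>a<m 1. \<Sum>a'<n 1. \<Sum>b'<n 2. \<Sum>c'<n 3.
        \<phi> $ a * (A $$ (a, a') * B $$ (b, b') * C $$ (c, c') * T a' b' c'))"
    using bc A B C by (simp add: flattening_def tensor_map_def sum_distrib_left)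
  also have "\<dots> = (\<Sum>a'<n 1. \<Sum>b'<n 2. \<Sum>c'<n 3. \<Sum>a<m 1.
        \<phi> $ a * (A $$ (a, a') * B $$ (b, b') * C $$ (c, c') * T a' b' c'))"
    by (rule trans[OF sum.swap], rule sum.cong[OF refl], rule trans[OF sum.swap],
      rule sum.cong[OF refl], rule sum.swap)
  \<comment> \<open>This is the order of summation in which the matrix product on the right
    unfolds.\<close>
  also have "\<dots> = (\<Sum>c'<n 3. \<Sum>b'<n 2. \<Sum>a'<n 1. \<Sum>a<m 1.
        \<phi> $ a * (A $$ (a, a') * B $$ (b, b') * C $$ (c, c') * T a' b' c'))"
    by (rule trans[OF sum.swap], rule trans[OF _ sum.swap], rule sum.cong[OF refl], rule sum.swap)
  also have "\<dots> = (B * flattening n T 1 (A\<^sup>T *\<^sub>v \<phi>) * C\<^sup>T) $$ (b, c)"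
    using bc A B C \<phi>
    by (simp add: flattening_def scalar_prod_def sum_distrib_left sum_distrib_right
        atLeast0LessThan mult_ac)
  finally show "flattening m (tensor_map A B C T) 1 \<phi> $$ (b, c) =
    (B * flattening n T 1 (A\<^sup>T *\<^sub>v \<phi>) * C\<^sup>T) $$ (b, c)" .
qed (use B C in \<open>simp_all add: flattening_def\<close>)

lemma flattening_unit_vec:
  assumes "m 1 > 0"
  shows "flattening m S 1 (unit_vec (m 1) 0) =
    mat (m 2) (m 3) (\<lambda>(b, c). S 0 b c :: 'a :: comm_semiring_1)"
proof -
  have "(\<Sum>a<m 1. unit_vec (m 1) 0 $ a * S a b c) = S 0 b c" for b c
    using assms by (simp add: if_distrib[where f = "\<lambda>u. u * v" for v] cong: if_cong)
  then show ?thesis by (simp add: flattening_def)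
qed

lemma mat_rank_flattening_le:
  assumes "\<phi> \<in> carrier_vec (n i)"
  shows "mat_rank (flattening n T i \<phi>) \<le> max_rank n T i"
  unfolding max_rank_def using assms by (intro Max_ge finite_flattening_ranks) simp

text \<open>Each matrix in the flattening space of the image is \<open>B * M * C\<^sup>T\<close>
  with \<open>M\<close> in that of \<open>T\<close>, so its rank is at most that of
  \<open>M\<close>; the other two bounds come from its format.\<close>

lemma max_rank_tensor_map_le:
  fixes T :: "'a :: field tensor3" and n m :: "nat \<Rightarrow> nat"
  assumes A: "A \<in> carrier_mat (m 1) (n 1)" and B: "B \<in> carrier_mat (m 2) (n 2)"
    and C: "C \<in> carrier_mat (m 3) (n 3)"
  shows "max_rank m (tensor_map A B C T) 1 \<le> min (max_rank n T 1) (min (m 2) (m 3))"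
proof -
  let ?S = "tensor_map A B C T"
  obtain \<phi> where \<phi>: "\<phi> \<in> carrier_vec (m 1)" "max_rank m ?S 1 = mat_rank (flattening m ?S 1 \<phi>)"
    using max_rank_attained by blast
  have F: "flattening m ?S 1 \<phi> \<in> carrier_mat (m 2) (m 3)" by (simp add: flattening_def)
  have "mat_rank (flattening m ?S 1 \<phi>) \<le> mat_rank (flattening n T 1 (A\<^sup>T *\<^sub>v \<phi>))"
    unfolding flattening_tensor_map[where m = m and n = n, OF A B C \<phi>(1)]
    using B C by (intro mat_rank_mult_le[of B "m 2" "n 2" _ "n 3" _ "m 3"])
      (auto simp: flattening_def)
  also have "\<dots> \<le> max_rank n T 1" using A \<phi> by (intro mat_rank_flattening_le) auto
  finally show ?thesis
    using \<phi>(2) F vec_space.rank_le_nr[OF F] vec_space.rank_le_nc[OF F] by simp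
qed

text \<open>The slice at index 0 is the value of the flattening at the first basis functional, so
  its rank is a lower bound.\<close>

lemma max_rank_ge_slice_minor:
  fixes S :: "'a :: field tensor3" and m :: "nat \<Rightarrow> nat"
  assumes "m 1 > 0" "r \<le> m 2" "r \<le> m 3"
    and "det (mat r r (\<lambda>(b, c). S 0 b c)) \<noteq> 0"
  shows "r \<le> max_rank m S 1"
proof -
  note F = flattening_unit_vec[where m = m and S = S, OF assms(1)]
  have "mat r r (\<lambda>(b, c). S 0 b c) =
      mat r r (\<lambda>(b, c). flattening m S 1 (unit_vec (m 1) 0) $$ (b, c))"
    unfolding F using assms(2,3) by (intro eq_matI) auto
  then have "r \<le> mat_rank (flattening m S 1 (unit_vec (m 1) 0))"
    using assms by (intro mat_rank_ge_top_left_minor) (auto simp: F[simplified])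
  then show ?thesis using mat_rank_flattening_le[of "unit_vec (m 1) 0" m 1 S] by simp
qed

text \<open>Supplies a point at which the minor of the first slice is 1: pull a flattening of
  maximal rank into that slice and normalise it to an identity block.\<close>

lemma restriction_with_identity_slice:
  fixes T :: "'a :: field tensor3" and n m :: "nat \<Rightarrow> nat"
  assumes m1: "m 1 > 0" and r: "r \<le> max_rank n T 1" "r \<le> m 2" "r \<le> m 3"
  shows "\<exists>A \<in> carrier_mat (m 1) (n 1). \<exists>B \<in> carrier_mat (m 2) (n 2). \<exists>C \<in> carrier_mat (m 3) (n 3).
    mat r r (\<lambda>(b, c). tensor_map A B C T 0 b c) = 1\<^sub>m r"
proof -
  obtain \<psi> where \<psi>: "\<psi> \<in> carrier_vec (n 1)" "max_rank n T 1 = mat_rank (flattening n T 1 \<psi>)"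
    using max_rank_attained by blast
  let ?M = "flattening n T 1 \<psi>"
  have M: "?M \<in> carrier_mat (n 2) (n 3)" by (simp add: flattening_def)
  obtain P Q where PQ: "P \<in> carrier_mat r (n 2)" "Q \<in> carrier_mat (n 3) r" "P * ?M * Q = 1\<^sub>m r"
    using vec_space.identity_factor_of_rank[OF M, of r] r(1) \<psi>(2) M by auto
  \<comment> \<open>Every row of \<open>A\<close> is \<psi>, in particular row 0, so the first basis
    functional pulls back to \<psi>. \<open>B\<close> and \<open>C\<close> are \<open>P\<close> and
    the transpose of \<open>Q\<close>, padded with zero rows to the required format.\<close>
  define A where "A = mat (m 1) (n 1) (\<lambda>(a, a'). \<psi> $ a')"
  define B where "B = mat (m 2) (n 2) (\<lambda>(b, b'). if b < r then P $$ (b, b') else 0)"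
  define C where "C = mat (m 3) (n 3) (\<lambda>(c, c'). if c < r then Q $$ (c', c) else 0)"
  have A: "A \<in> carrier_mat (m 1) (n 1)" and B: "B \<in> carrier_mat (m 2) (n 2)"
    and C: "C \<in> carrier_mat (m 3) (n 3)" by (simp_all add: A_def B_def C_def)
  let ?S = "tensor_map A B C T"
  have e: "A\<^sup>T *\<^sub>v unit_vec (m 1) 0 = \<psi>"
    using m1 \<psi>(1) by (intro eq_vecI) (auto simp: A_def)
  have "?S 0 b c = 1\<^sub>m r $$ (b, c)" if bc: "b < r" "c < r" for b c
  proof -
    have bc': "b < m 2" "c < m 3" using bc r by auto
    have "?S 0 b c = flattening m ?S 1 (unit_vec (m 1) 0) $$ (b, c)"
      unfolding flattening_unit_vec[where m = m, OF m1] using bc' by simp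
    also have "\<dots> = (B * ?M * C\<^sup>T) $$ (b, c)"
      using flattening_tensor_map[where m = m and n = n, OF A B C unit_vec_carrier] e by simp
    also have "\<dots> = row (B * ?M) b \<bullet> col C\<^sup>T c" using bc' B C by simp
    also have "col C\<^sup>T c = col Q c"
      using bc bc' PQ by (intro eq_vecI) (auto simp: C_def)
    also have "row B b = row P b"
      using bc bc' PQ by (intro eq_vecI) (auto simp: B_def)
    then have "row (B * ?M) b = row (P * ?M) b"
      using bc bc' B M PQ by (intro eq_vecI) auto
    also have "row (P * ?M) b \<bullet> col Q c = (P * ?M * Q) $$ (b, c)" using bc PQ(1,2) by simp
    finally show ?thesis using PQ(3) by simp
  qed
  then have "mat r r (\<lambda>(b, c). ?S 0 b c) = 1\<^sub>m r" by (intro eq_matI) auto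
  then show ?thesis using A B C by blast
qed

section \<open>Matrix entries as coordinates\<close>

text \<open>Makes the entries of several matrices the coordinates of one point; \<open>k\<close> tells the matrices apart.\<close>

definition coord_mat :: "nat \<Rightarrow> nat \<Rightarrow> nat \<Rightarrow> (nat \<times> nat \<times> nat \<Rightarrow> 'a) \<Rightarrow> 'a mat" where
  "coord_mat k p q x = mat p q (\<lambda>(i, j). x (k, i, j))"

lemma coord_mat_carrier [simp]: "coord_mat k p q x \<in> carrier_mat p q"
  by (simp add: coord_mat_def)

text \<open>Lets matrices that meet one condition be read as a point at which the corresponding
  polynomial is nonzero.\<close>

lemma coord_mat_surj:
  assumes "A \<in> carrier_mat p1 q1" "B \<in> carrier_mat p2 q2" "C \<in> carrier_mat p3 q3"
  shows "\<exists>x. coord_mat 1 p1 q1 x = A \<and> coord_mat 2 p2 q2 x = B \<and> coord_mat 3 p3 q3 x = C"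
  using assms
  by (intro exI[of _ "\<lambda>(k, i, j). (if k = 1 then A else if k = 2 then B else C) $$ (i, j)"])
    (auto simp: coord_mat_def)

text \<open>Inside the box an entry of the image is a trilinear expression in the entries of the
  three matrices; outside it is the constant 0.\<close>

lemma poly_on_lines_tensor_map:
  fixes T :: "'a :: comm_ring_1 tensor3"
  shows "poly_on_lines (\<lambda>x. tensor_map (coord_mat 1 p1 q1 x) (coord_mat 2 p2 q2 x)
    (coord_mat 3 p3 q3 x) T a b c)"
proof (cases "a < p1 \<and> b < p2 \<and> c < p3")
  case True
  then have "tensor_map (coord_mat 1 p1 q1 x) (coord_mat 2 p2 q2 x) (coord_mat 3 p3 q3 x) T a b c =
      (\<Sum>a'<q1. \<Sum>b'<q2. \<Sum>c'<q3. x (1, a, a') * x (2, b, b') * x (3, c, c') * T a' b' c')" for x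
    by (simp add: tensor_map_def coord_mat_def)
  then show ?thesis
    by (simp only:) (intro poly_on_lines_sum poly_on_lines_mult poly_on_lines_coord
      poly_on_lines_const)
next
  case False
  then show ?thesis by (auto simp: tensor_map_def coord_mat_def poly_on_lines_const)
qed

section \<open>Permuting the tensor factors\<close>

text \<open>This and the next three lemmas carry the results on the first factor over to factors 2
  and 3.\<close>

lemma tensor_map_swap12:
  "tensor_map B A C (\<lambda>b a c. T a b c) = (\<lambda>b a c. tensor_map A B C T a b c)"
  unfolding tensor_map_def
  by (intro ext) (subst sum.swap, auto intro!: sum.cong simp: mult_ac)

lemma tensor_map_rotate:
  "tensor_map C A B (\<lambda>c a b. T a b c) = (\<lambda>c a b. tensor_map A B C T a b c)"
proof (intro ext)
  fix c a b
  have "(\<Sum>c'<dim_col C. \<Sum>a'<dim_col A. \<Sum>b'<dim_col B.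
          C $$ (c, c') * A $$ (a, a') * B $$ (b, b') * T a' b' c') =
        (\<Sum>a'<dim_col A. \<Sum>b'<dim_col B. \<Sum>c'<dim_col C.
          C $$ (c, c') * A $$ (a, a') * B $$ (b, b') * T a' b' c')"
    by (rule trans[OF sum.swap], rule sum.cong[OF refl], rule sum.swap)
  then show "tensor_map C A B (\<lambda>c a b. T a b c) c a b = tensor_map A B C T a b c"
    by (auto simp: tensor_map_def mult_ac)
qed

lemma max_rank_2: "max_rank n T 2 = max_rank (n(1 := n 2, 2 := n 1)) (\<lambda>b a c. T a b c) 1"
  by (simp add: max_rank_def flattening_def)

text \<open>A rotation, unlike exchanging factors 1 and 3, keeps the two remaining factors in
  increasing order, so the flattenings agree without a transpose.\<close>

lemma max_rank_3:
  "max_rank n T 3 = max_rank (n(1 := n 3, 2 := n 1, 3 := n 2)) (\<lambda>c a b. T a b c) 1"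
  by (simp add: max_rank_def flattening_def)

section \<open>Combining the three conditions\<close>

theorem lemma3p1:
  fixes T :: "('a :: alg_closed_field) tensor3"
    and n m :: "nat \<Rightarrow> nat"
  assumes "T \<in> tensor_space n"
    and "\<forall>i \<in> {1, 2, 3}. m i > 0"
  shows "\<exists>S \<in> tensor_space m. restricts_to n m T S \<and>
           (\<forall>i j k. {i, j, k} = {1, 2, 3} \<longrightarrow>
              max_rank m S i = min (max_rank n T i) (min (m j) (m k)))"
proof -
  have pos: "m 1 > 0" "m 2 > 0" "m 3 > 0" using assms(2) by auto
  let ?n2 = "n(1 := n 2, 2 := n 1)" and ?m2 = "m(1 := m 2, 2 := m 1)"
  let ?n3 = "n(1 := n 3, 2 := n 1, 3 := n 2)" and ?m3 = "m(1 := m 3, 2 := m 1, 3 := m 2)"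
  let ?T2 = "\<lambda>b a c. T a b c" and ?T3 = "\<lambda>c a b. T a b c"
  define A :: "_ \<Rightarrow> 'a mat" where "A = coord_mat 1 (m 1) (n 1)"
  define B :: "_ \<Rightarrow> 'a mat" where "B = coord_mat 2 (m 2) (n 2)"
  define C :: "_ \<Rightarrow> 'a mat" where "C = coord_mat 3 (m 3) (n 3)"
  have ABC: "A x \<in> carrier_mat (m 1) (n 1)" "B x \<in> carrier_mat (m 2) (n 2)"
    "C x \<in> carrier_mat (m 3) (n 3)" for x by (simp_all add: A_def B_def C_def)
  define S where "S x = tensor_map (A x) (B x) (C x) T" for x
  define r1 where "r1 = min (max_rank n T 1) (min (m 2) (m 3))"
  define r2 where "r2 = min (max_rank n T 2) (min (m 1) (m 3))"
  define r3 where "r3 = min (max_rank n T 3) (min (m 1) (m 2))"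
  have r: "r1 \<le> max_rank n T 1" "r1 \<le> m 2" "r1 \<le> m 3" "r2 \<le> max_rank n T 2" "r2 \<le> m 1"
    "r2 \<le> m 3" "r3 \<le> max_rank n T 3" "r3 \<le> m 1" "r3 \<le> m 2"
    unfolding r1_def r2_def r3_def by linarith+
  \<comment> \<open>The three minors as functions of the point \<open>x\<close> that holds all
    matrix entries. A minor of size 0 is 1, so rank 0 needs no separate case.\<close>
  define f1 where "f1 x = det (mat r1 r1 (\<lambda>(b, c). S x 0 b c))" for x
  define f2 where "f2 x = det (mat r2 r2 (\<lambda>(a, c). S x a 0 c))" for x
  define f3 where "f3 x = det (mat r3 r3 (\<lambda>(a, b). S x a b 0))" for x
  have S_poly: "poly_on_lines (\<lambda>x. S x a b c)" for a b c
    unfolding S_def A_def B_def C_def by (rule poly_on_lines_tensor_map)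
  have f_poly: "poly_on_lines f1" "poly_on_lines f2" "poly_on_lines f3"
    unfolding f1_def f2_def f3_def by (intro poly_on_lines_det S_poly)+
  have surj: "\<exists>x. A x = A' \<and> B x = B' \<and> C x = C'"
    if "A' \<in> carrier_mat (m 1) (n 1)" "B' \<in> carrier_mat (m 2) (n 2)"
      "C' \<in> carrier_mat (m 3) (n 3)" for A' B' C'
    unfolding A_def B_def C_def using that by (rule coord_mat_surj)
  have "\<exists>x. f1 x \<noteq> 0"
  proof -
    obtain A' B' C' where *: "A' \<in> carrier_mat (m 1) (n 1)" "B' \<in> carrier_mat (m 2) (n 2)"
      "C' \<in> carrier_mat (m 3) (n 3)" "mat r1 r1 (\<lambda>(b, c). tensor_map A' B' C' T 0 b c) = 1\<^sub>m r1"
      using restriction_with_identity_slice[of m r1 n T] pos r by blast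
    then obtain x where "A x = A'" "B x = B'" "C x = C'" using surj by blast
    with *(4) have "f1 x = det (1\<^sub>m r1)" by (simp add: f1_def S_def)
    then show ?thesis by (intro exI[of _ x]) simp
  qed
  moreover have "\<exists>x. f2 x \<noteq> 0"
  proof -
    \<comment> \<open>Factor 2 stands first in \<open>?T2\<close>, so \<open>B'\<close> is the
      matrix acting on the first place.\<close>
    obtain A' B' C' where *: "A' \<in> carrier_mat (m 1) (n 1)" "B' \<in> carrier_mat (m 2) (n 2)"
      "C' \<in> carrier_mat (m 3) (n 3)"
      "mat r2 r2 (\<lambda>(a, c). tensor_map B' A' C' ?T2 0 a c) = 1\<^sub>m r2"
      using restriction_with_identity_slice[of ?m2 r2 ?n2 ?T2] pos r
      by (auto simp: max_rank_2)
    then obtain x where "A x = A'" "B x = B'" "C x = C'" using surj by blast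
    with *(4) have "f2 x = det (1\<^sub>m r2)"
      by (simp add: f2_def S_def tensor_map_swap12[where T = T])
    then show ?thesis by (intro exI[of _ x]) simp
  qed
  moreover have "\<exists>x. f3 x \<noteq> 0"
  proof -
    obtain A' B' C' where *: "A' \<in> carrier_mat (m 1) (n 1)" "B' \<in> carrier_mat (m 2) (n 2)"
      "C' \<in> carrier_mat (m 3) (n 3)"
      "mat r3 r3 (\<lambda>(a, b). tensor_map C' A' B' ?T3 0 a b) = 1\<^sub>m r3"
      using restriction_with_identity_slice[of ?m3 r3 ?n3 ?T3] pos r
      by (auto simp: max_rank_3)
    then obtain x where "A x = A'" "B x = B'" "C x = C'" using surj by blast
    with *(4) have "f3 x = det (1\<^sub>m r3)"
      by (simp add: f3_def S_def tensor_map_rotate[where T = T])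
    then show ?thesis by (intro exI[of _ x]) simp
  qed
  ultimately obtain x1 x2 x3 where "f1 x1 \<noteq> 0" "f2 x2 \<noteq> 0" "f3 x3 \<noteq> 0" by blast
  \<comment> \<open>First a common nonzero of \<open>f1\<close> and \<open>f2\<close>; their product
    is again polynomial on lines, so the same argument then brings in \<open>f3\<close>.\<close>
  then obtain x12 where "f1 x12 * f2 x12 \<noteq> 0"
    using poly_on_lines_common_nonzero[OF infinite_UNIV_alg_closed f_poly(1) _ f_poly(2)] by blast
  then obtain x where "f1 x * f2 x * f3 x \<noteq> 0"
    using poly_on_lines_common_nonzero[OF infinite_UNIV_alg_closed
      poly_on_lines_mult[OF f_poly(1,2)] _ f_poly(3)] \<open>f3 x3 \<noteq> 0\<close> by blast
  then have x: "f1 x \<noteq> 0" "f2 x \<noteq> 0" "f3 x \<noteq> 0" by auto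
  have rank1: "max_rank m (S x) 1 = r1"
  proof (rule antisym)
    \<comment> \<open>The upper bound holds at every point; only the lower bound uses the choice of
      \<open>x\<close>.\<close>
    show "max_rank m (S x) 1 \<le> r1"
      unfolding S_def r1_def by (rule max_rank_tensor_map_le[where m = m and n = n, OF ABC])
    show "r1 \<le> max_rank m (S x) 1"
      using max_rank_ge_slice_minor[of m r1 "S x"] pos r x(1) by (auto simp: f1_def)
  qed
  have rank2: "max_rank m (S x) 2 = r2"
  proof (rule antisym)
    show "max_rank m (S x) 2 \<le> r2"
      using max_rank_tensor_map_le[of "B x" ?m2 ?n2 "A x" "C x" ?T2] ABC
      by (simp add: max_rank_2 r2_def S_def tensor_map_swap12[where T = T])
    show "r2 \<le> max_rank m (S x) 2"
      unfolding max_rank_2[of m] using pos r x(2)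
      by (intro max_rank_ge_slice_minor) (auto simp: f2_def)
  qed
  have rank3: "max_rank m (S x) 3 = r3"
  proof (rule antisym)
    show "max_rank m (S x) 3 \<le> r3"
      using max_rank_tensor_map_le[of "C x" ?m3 ?n3 "A x" "B x" ?T3] ABC
      by (simp add: max_rank_3 r3_def S_def tensor_map_rotate[where T = T])
    show "r3 \<le> max_rank m (S x) 3"
      unfolding max_rank_3[of m] using pos r x(3)
      by (intro max_rank_ge_slice_minor) (auto simp: f3_def)
  qed
  have ranks: "max_rank m (S x) i = min (max_rank n T i) (min (m j) (m k))"
    if ijk: "{i, j, k} = {1, 2, 3}" for i j k
  proof -
    \<comment> \<open>Equality of the sets forces \<open>i\<close>, \<open>j\<close>,
      \<open>k\<close> to be distinct; \<open>j\<close> and \<open>k\<close> may come in either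
      order, which the minimum ignores.\<close>
    have "i \<in> {1, 2, 3}" "j \<in> {1, 2, 3}" "k \<in> {1, 2, 3}"
      "1 \<in> {i, j, k}" "2 \<in> {i, j, k}" "3 \<in> {i, j, k}" using ijk by auto
    then consider "i = 1" "{j, k} = {2, 3}" | "i = 2" "{j, k} = {1, 3}" | "i = 3" "{j, k} = {1, 2}"
      by auto
    then show ?thesis
    proof cases
      case 1
      then show ?thesis using rank1 by (auto simp: doubleton_eq_iff r1_def min.commute[of "m 3"])
    next
      case 2
      then show ?thesis using rank2 by (auto simp: doubleton_eq_iff r2_def min.commute[of "m 3"])
    next
      case 3
      then show ?thesis
        using rank3 by (auto simp: doubleton_eq_iff r3_def min.commute[of "m 2"])
    qed
  qed
  have "S x \<in> tensor_space m"
    using ABC[of x] by (auto simp: tensor_space_def S_def tensor_map_def)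
  moreover have "restricts_to n m T (S x)"
    unfolding restricts_to_def S_def using ABC by blast
  ultimately show ?thesis using ranks by blast
qed

end
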